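(* There exists a topological dynamical system $(X,T)$ that is not minimal, is transitive and strong mixing, and such that the set $$\{x\in X:\text{ for every open } U\ni x \text{ there exists an integer } n\ge 1 \text{ with } T^{n}x\in U \text{ and } T^{2n}x\in U\}$$ consists of a single point, and hence is not dense in $X$.
   Context: A topological dynamical system $(X,T)$ is a (non-empty) compact metric space $X$ with a homeomorphism $T:X\to X$. It is minimal if $X$ contains no proper non-empty closed $T$-invariant subset. It is transitive if for all non-empty open $U,V\subseteq X$ there is $n$ with $U\cap T^{-n}V\neq\emptyset$. It is strong mixing if for all non-empty open $U,V\subseteq X$ there is $N\in\mathbb{N}$ such that $U\cap T^{-n}V\neq\emptyset$ for all $n\ge N$. *)

theory Defs
  imports "HOL-Analysis.Analysis"
begin

definition topological_dynamical_system :: "'a metric \<Rightarrow> ('a \<Rightarrow> 'a) \<Rightarrow> bool" where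
  "topological_dynamical_system X T \<longleftrightarrow>
     mspace X \<noteq> {} \<and>
     compact_space (mtopology_of X) \<and>
     homeomorphic_map (mtopology_of X) (mtopology_of X) T"

(* An invariant set is a set Y with T ` Y \<subseteq> Y. For compact X, minimality is the same
   notion if T ` Y = Y is required instead. *)
definition minimal_system :: "'a metric \<Rightarrow> ('a \<Rightarrow> 'a) \<Rightarrow> bool" where
  "minimal_system X T \<longleftrightarrow>
     \<not> (\<exists>Y. Y \<subset> mspace X \<and> Y \<noteq> {} \<and> closedin (mtopology_of X) Y \<and> T ` Y \<subseteq> Y)"

(* In the next two definitions the vimage is taken in the whole type, which is harmless
   because it is only intersected with U, a subset of the space. *)
definition transitive_system :: "'a metric \<Rightarrow> ('a \<Rightarrow> 'a) \<Rightarrow> bool" where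
  "transitive_system X T \<longleftrightarrow>
     (\<forall>U V. openin (mtopology_of X) U \<and> U \<noteq> {} \<and> openin (mtopology_of X) V \<and> V \<noteq> {} \<longrightarrow>
        (\<exists>n::nat. U \<inter> (T ^^ n) -` V \<noteq> {}))"

definition strong_mixing_system :: "'a metric \<Rightarrow> ('a \<Rightarrow> 'a) \<Rightarrow> bool" where
  "strong_mixing_system X T \<longleftrightarrow>
     (\<forall>U V. openin (mtopology_of X) U \<and> U \<noteq> {} \<and> openin (mtopology_of X) V \<and> V \<noteq> {} \<longrightarrow>
        (\<exists>N::nat. \<forall>n\<ge>N. U \<inter> (T ^^ n) -` V \<noteq> {}))"

definition double_recurrent_points :: "'a metric \<Rightarrow> ('a \<Rightarrow> 'a) \<Rightarrow> 'a set" where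
  "double_recurrent_points X T =
     {x \<in> mspace X. \<forall>U. openin (mtopology_of X) U \<and> x \<in> U \<longrightarrow>
        (\<exists>n::nat. n \<ge> 1 \<and> (T ^^ n) x \<in> U \<and> (T ^^ (2 * n)) x \<in> U)}"

end

theory Submission
  imports Defs
begin

text \<open>
  The space consists of the indicator functions of all sets of integers without a three-term
  arithmetic progression, and the map is the shift. If a point \<open>x\<close> has \<open>x m = 1\<close>, then
  a double return to the open set of points with value \<open>1\<close> at \<open>m\<close> would produce the
  progression \<open>m, m + n, m + 2n\<close> in the support of \<open>x\<close>. So the only candidate left is the zero
  function, which is a fixed point and therefore doubly recurrent. The fixed point also destroys
  minimality, and its being closed while the space has other points gives non-density.

  Excluding progressions is no obstacle to mixing: basic open sets restrict only a finite window
  of coordinates, and two finite progression-free sets that are far apart compared to their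
  diameters have a progression-free union, because a progression with terms in both would have
  two terms in one of them and hence a step too short to reach the other
  (\<open>progression_free_glue\<close>).
\<close>

definition progression_free :: "int set \<Rightarrow> bool" where
  "progression_free A \<longleftrightarrow> (\<forall>i d. d > 0 \<longrightarrow> \<not> (i \<in> A \<and> i + d \<in> A \<and> i + 2 * d \<in> A))"

definition progression_free_sequences :: "(int \<Rightarrow> nat) set" where
  "progression_free_sequences = {x. (\<forall>i. x i \<le> 1) \<and> progression_free {i. x i = 1}}"

definition left_shift :: "(int \<Rightarrow> nat) \<Rightarrow> (int \<Rightarrow> nat)" where
  "left_shift x = (\<lambda>i. x (i + 1))"

section \<open>Progression-free sets\<close>

lemma progression_free_mono: "progression_free B \<Longrightarrow> A \<subseteq> B \<Longrightarrow> progression_free A"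
  unfolding progression_free_def by blast

lemma progression_free_translate:
  assumes "progression_free A"
  shows "progression_free {i. i + k \<in> A}"
  unfolding progression_free_def
proof (intro allI impI notI)
  fix i d :: int
  assume "d > 0" and "i \<in> {i. i + k \<in> A} \<and> i + d \<in> {i. i + k \<in> A} \<and> i + 2 * d \<in> {i. i + k \<in> A}"
  then have "i + k \<in> A" "(i + k) + d \<in> A" "(i + k) + 2 * d \<in> A"
    by (simp_all add: algebra_simps)
  with \<open>d > 0\<close> assms show False unfolding progression_free_def by blast
qed

text \<open>
  As \<open>B\<close> lies to the right of \<open>A\<close>, a progression meeting both sets has its first term in \<open>A\<close> and
  its last term in \<open>B\<close>. Wherever the middle term lies, the step is at most \<open>2 * M\<close>, the bound on
  the diameters, which is smaller than the gap \<open>n - 2 * M\<close> between the two sets.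
\<close>
lemma progression_free_glue:
  assumes "progression_free A" "progression_free B"
    and "A \<subseteq> {-M..M}" "B \<subseteq> {n - M..n + M}" "n > 4 * M"
  shows "progression_free (A \<union> B)"
  unfolding progression_free_def
proof (intro allI impI notI)
  fix i d :: int
  assume d: "d > 0" and "i \<in> A \<union> B \<and> i + d \<in> A \<union> B \<and> i + 2 * d \<in> A \<union> B"
  moreover have "\<not> (i \<in> A \<and> i + d \<in> A \<and> i + 2 * d \<in> A)" "\<not> (i \<in> B \<and> i + d \<in> B \<and> i + 2 * d \<in> B)"
    using assms(1,2) d unfolding progression_free_def by blast+
  moreover have "-M \<le> j \<and> j \<le> M" if "j \<in> A" for j
    using assms(3) that by auto
  moreover have "n - M \<le> j \<and> j \<le> n + M" if "j \<in> B" for j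
    using assms(4) that by auto
  ultimately show False
    using assms(5) by (smt (verit) Un_iff)
qed

section \<open>The space and the shift\<close>

text \<open>
  Only the topology matters for the dynamics, so any compatible metric serves.
\<close>
lemma progression_free_sequences_metrizable:
  obtains X :: "(int \<Rightarrow> nat) metric" where "mtopology_of X = top_of_set progression_free_sequences"
proof -
  have "(euclidean :: nat topology) = discrete_topology UNIV"
    by (auto simp: topology_eq open_discrete)
  then have "metrizable_space (product_topology (\<lambda>_ :: int. euclidean :: nat topology) UNIV)"
    by (simp add: metrizable_space_product_topology)
  then have "metrizable_space (top_of_set progression_free_sequences)"
    by (simp add: euclidean_product_topology metrizable_space_subtopology)
  then obtain M d where "Metric_space M d"
    "top_of_set progression_free_sequences = Metric_space.mtopology M d"
    unfolding metrizable_space_def by blast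
  then have "mtopology_of (metric (M, d)) = top_of_set progression_free_sequences"
    by (simp add: mtopology_of_def Metric_space.mspace_metric Metric_space.mdist_metric)
  then show thesis ..
qed

lemma mspace_if_mtopology_of: "mtopology_of X = top_of_set S \<Longrightarrow> mspace X = S"
  using topspace_mtopology_of [of X] by simp

lemma zero_progression_free: "(\<lambda>_. 0) \<in> progression_free_sequences"
  by (simp add: progression_free_sequences_def progression_free_def)

lemma left_shift_funpow: "(left_shift ^^ n) x = (\<lambda>i. x (i + int n))"
  by (induction n) (auto simp: left_shift_def algebra_simps)

lemma translate_in_progression_free_sequences:
  assumes "x \<in> progression_free_sequences"
  shows "(\<lambda>i. x (i + k)) \<in> progression_free_sequences"
  using assms progression_free_translate [of "{i. x i = 1}" k]
  by (simp add: progression_free_sequences_def)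

lemma open_coordinate_eq_1: "open {x :: int \<Rightarrow> nat. x i = 1}"
  using open_vimage [OF open_discrete [of "{1 :: nat}"] continuous_on_product_coordinates [of i]]
  by (simp add: vimage_def)

lemma homeomorphic_map_left_shift:
  "homeomorphic_map (top_of_set progression_free_sequences)
     (top_of_set progression_free_sequences) left_shift"
proof (rule homeomorphic_maps_imp_map)
  have cont: "continuous_on progression_free_sequences (\<lambda>x i. x (i + k))" for k :: int
    by (intro continuous_on_coordinatewise_then_product
        continuous_on_subset [OF continuous_on_product_coordinates] subset_UNIV)
  show "homeomorphic_maps (top_of_set progression_free_sequences)
     (top_of_set progression_free_sequences) left_shift (\<lambda>x i. x (i + (-1)))"
    using cont [of 1] cont [of "-1"] translate_in_progression_free_sequences [of _ 1]
      translate_in_progression_free_sequences [of _ "-1"]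
    by (auto simp: homeomorphic_maps_def left_shift_def [abs_def])
qed

text \<open>
  Each instance of the defining condition involves three coordinates with discrete values, so the
  space is closed in the product of the finite sets \<open>{0, 1}\<close>.
\<close>
lemma compact_progression_free_sequences: "compact progression_free_sequences"
proof -
  have "closed {x :: int \<Rightarrow> nat. \<not> (x i = 1 \<and> x (i + d) = 1 \<and> x (i + 2 * d) = 1)}" for i d
    by (intro closed_Collect_neg open_Collect_conj open_coordinate_eq_1)
  then have closed: "closed {x :: int \<Rightarrow> nat. progression_free {i. x i = 1}}"
    unfolding progression_free_def
    by (intro closed_Collect_all closed_Collect_imp) simp_all
  have "compact (PiE UNIV (\<lambda>_ :: int. {..1 :: nat}))"
    unfolding compactin_euclidean_iff [symmetric] euclidean_product_topology [symmetric]
    by (subst compactin_PiE) (simp add: finite_imp_compact)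
  then have "compact (PiE UNIV (\<lambda>_ :: int. {..1 :: nat}) \<inter> {x. progression_free {i. x i = 1}})"
    using closed by (rule compact_Int_closed)
  moreover have "PiE UNIV (\<lambda>_ :: int. {..1 :: nat}) \<inter> {x. progression_free {i. x i = 1}} =
      progression_free_sequences"
    by (auto simp: progression_free_sequences_def PiE_UNIV_domain)
  ultimately show ?thesis
    by simp
qed

section \<open>Mixing\<close>

lemma open_contains_finite_window:
  fixes x :: "int \<Rightarrow> nat"
  assumes "open U" "x \<in> U"
  obtains M where "M \<ge> 0" and "\<And>y. (\<And>i. i \<in> {-M..M} \<Longrightarrow> y i = x i) \<Longrightarrow> y \<in> U"
proof -
  have "openin (product_topology (\<lambda>_ :: int. euclidean :: nat topology) UNIV) U"
    using assms(1) by (simp add: euclidean_product_topology)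
  with assms(2) obtain W where W: "finite {i. W i \<noteq> (UNIV :: nat set)}"
    "x \<in> PiE UNIV W" "PiE UNIV W \<subseteq> U"
    unfolding openin_product_topology_alt by force
  define M where "M = Max (insert 0 (abs ` {i. W i \<noteq> UNIV}))"
  have M: "\<bar>i\<bar> \<le> M" if "W i \<noteq> UNIV" for i
    unfolding M_def by (rule Max_ge) (use W(1) that in auto)
  show thesis
  proof
    show "M \<ge> 0"
      unfolding M_def by (rule Max_ge) (use W(1) in auto)
    fix y :: "int \<Rightarrow> nat"
    assume y: "\<And>i. i \<in> {-M..M} \<Longrightarrow> y i = x i"
    have "y i \<in> W i" for i
    proof (cases "W i = UNIV")
      case False
      with M have "y i = x i" by (intro y) (force simp: abs_le_iff)
      with W(2) show ?thesis by (auto simp: PiE_UNIV_domain)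
    qed simp
    with W(3) show "y \<in> U" by (auto simp: PiE_UNIV_domain)
  qed
qed

text \<open>
  Given windows of two points, the indicator function of the glued windows lies in the first open
  set now and in the second one after the required number of steps.
\<close>
lemma strong_mixing_progression_free_shift:
  assumes "mtopology_of X = top_of_set progression_free_sequences"
  shows "strong_mixing_system X left_shift"
  unfolding strong_mixing_system_def assms
proof (intro allI impI, elim conjE)
  fix U V
  assume "openin (top_of_set progression_free_sequences) U" "U \<noteq> {}"
    and "openin (top_of_set progression_free_sequences) V" "V \<noteq> {}"
  then obtain U' V' x y where U': "open U'" "U = progression_free_sequences \<inter> U'"
    and V': "open V'" "V = progression_free_sequences \<inter> V'"
    and x: "x \<in> progression_free_sequences" "x \<in> U'"
    and y: "y \<in> progression_free_sequences" "y \<in> V'"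
    by (auto simp: openin_open)
  obtain K where K: "K \<ge> 0" "\<And>z. (\<And>i. i \<in> {-K..K} \<Longrightarrow> z i = x i) \<Longrightarrow> z \<in> U'"
    using open_contains_finite_window [OF U'(1) x(2)] by blast
  obtain L where L: "L \<ge> 0" "\<And>z. (\<And>i. i \<in> {-L..L} \<Longrightarrow> z i = y i) \<Longrightarrow> z \<in> V'"
    using open_contains_finite_window [OF V'(1) y(2)] by blast
  define M where "M = max K L"
  have binary: "x i = 0 \<or> x i = 1" "y i = 0 \<or> y i = 1" for i
    using x(1) y(1) by (auto simp: progression_free_sequences_def le_Suc_eq)
  have "U \<inter> (left_shift ^^ n) -` V \<noteq> {}" if n: "n \<ge> nat (4 * M + 1)" for n
  proof -
    have gap: "int n > 4 * M" using n by linarith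
    define A where "A = {i \<in> {-M..M}. x i = 1}"
    define B where "B = {i \<in> {int n - M..int n + M}. y (i - int n) = 1}"
    define z :: "int \<Rightarrow> nat" where "z i = of_bool (i \<in> A \<union> B)" for i
    have "progression_free A"
      using x(1) by (auto simp: A_def progression_free_sequences_def elim: progression_free_mono)
    moreover have "progression_free B"
      using y(1) progression_free_translate [of "{i. y i = 1}" "- int n"]
      by (auto simp: B_def progression_free_sequences_def elim: progression_free_mono)
    ultimately have "progression_free (A \<union> B)"
      by (rule progression_free_glue [where M = M]) (use gap in \<open>auto simp: A_def B_def\<close>)
    moreover have "{i. z i = 1} = A \<union> B"
      by (auto simp: z_def)
    ultimately have z: "z \<in> progression_free_sequences"
      by (simp add: progression_free_sequences_def z_def)
    have "z \<in> U'"
    proof (rule K(2))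
      fix i assume "i \<in> {-K..K}"
      then have "i \<in> {-M..M}" "i \<notin> B"
        using gap by (auto simp: M_def B_def)
      then show "z i = x i"
        using binary(1) [of i] by (auto simp: z_def A_def)
    qed
    moreover have "(\<lambda>i. z (i + int n)) \<in> V'"
    proof (rule L(2))
      fix i assume "i \<in> {-L..L}"
      then have "i \<in> {-M..M}" "i + int n \<notin> A"
        using gap by (auto simp: M_def A_def)
      then show "z (i + int n) = y i"
        using binary(2) [of i] by (auto simp: z_def B_def)
    qed
    ultimately have "z \<in> U \<inter> (left_shift ^^ n) -` V"
      using z translate_in_progression_free_sequences [OF z]
      by (simp add: U' V' left_shift_funpow)
    then show ?thesis by blast
  qed
  then show "\<exists>N. \<forall>n\<ge>N. U \<inter> (left_shift ^^ n) -` V \<noteq> {}"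
    by blast
qed

lemma strong_mixing_imp_transitive: "strong_mixing_system X T \<Longrightarrow> transitive_system X T"
  unfolding strong_mixing_system_def transitive_system_def by (meson order_refl)

section \<open>Double recurrence\<close>

lemma double_recurrent_points_progression_free_shift:
  assumes top: "mtopology_of X = top_of_set progression_free_sequences"
  shows "double_recurrent_points X left_shift = {\<lambda>_. 0}"
proof (intro equalityI subsetI)
  note [simp] = mspace_if_mtopology_of [OF top]
  fix x assume x: "x \<in> double_recurrent_points X left_shift"
  then have free: "\<And>i. x i \<le> 1" "progression_free {i. x i = 1}"
    by (auto simp: double_recurrent_points_def progression_free_sequences_def)
  have "x m \<noteq> 1" for m
  proof
    assume m: "x m = 1"
    define U where "U = progression_free_sequences \<inter> {y. y m = 1}"
    have "openin (mtopology_of X) U"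
      using open_coordinate_eq_1 [of m] by (auto simp: U_def top openin_open)
    moreover have "x \<in> U"
      using x m by (simp add: U_def double_recurrent_points_def)
    ultimately obtain n :: nat where n: "n \<ge> 1" "(left_shift ^^ n) x \<in> U" "(left_shift ^^ (2 * n)) x \<in> U"
      using x unfolding double_recurrent_points_def by blast
    then have "x (m + int n) = 1" "x (m + 2 * int n) = 1"
      by (simp_all add: U_def left_shift_funpow)
    moreover have "int n > 0"
      using n(1) by simp
    ultimately show False
      using free(2) m by (simp add: progression_free_def)
  qed
  then have "x m = 0" for m
    using free(1) [of m] by (metis le_neq_implies_less less_one)
  then show "x \<in> {\<lambda>_. 0}" by auto
next
  note [simp] = mspace_if_mtopology_of [OF top]
  fix x :: "int \<Rightarrow> nat" assume "x \<in> {\<lambda>_. 0}"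
  then show "x \<in> double_recurrent_points X left_shift"
    using zero_progression_free by (auto simp: double_recurrent_points_def left_shift_funpow)
qed

(* The type "int \<Rightarrow> nat" only supplies points: both the underlying set and the metric of X are
   arbitrary. As the type has the cardinality of the continuum, every compact metric space is
   isometric to some X of type "(int \<Rightarrow> nat) metric". *)
theorem theoremC:
  shows "\<exists>(X :: (int \<Rightarrow> nat) metric) T.
           topological_dynamical_system X T \<and>
           \<not> minimal_system X T \<and>
           transitive_system X T \<and>
           strong_mixing_system X T \<and>
           (\<exists>p. double_recurrent_points X T = {p}) \<and>
           mtopology_of X closure_of (double_recurrent_points X T) \<noteq> mspace X"
proof -
  obtain X :: "(int \<Rightarrow> nat) metric" where top: "mtopology_of X = top_of_set progression_free_sequences"
    by (rule progression_free_sequences_metrizable)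
  note [simp] = mspace_if_mtopology_of [OF top]
  let ?zero = "\<lambda>_ :: int. 0 :: nat"
  let ?one = "\<lambda>i :: int. of_bool (i = 0) :: nat"
  have one: "?one \<in> progression_free_sequences" "?one \<noteq> ?zero"
    by (auto simp: progression_free_sequences_def progression_free_def fun_eq_iff)
  have "t1_space (mtopology_of X)"
    by (simp only: mtopology_of_def Metric_space.t1_space_mtopology [OF Metric_space_mspace_mdist])
  then have closed_zero: "closedin (mtopology_of X) {?zero}"
    by (rule closedin_t1_singleton) (simp add: zero_progression_free)
  have "topological_dynamical_system X left_shift"
    unfolding topological_dynamical_system_def
    using zero_progression_free compact_progression_free_sequences homeomorphic_map_left_shift
    by (auto simp: top compact_space_subtopology)
  moreover have "\<not> minimal_system X left_shift"
    unfolding minimal_system_def not_not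
    using zero_progression_free one closed_zero
    by (intro exI [of _ "{?zero}"]) (auto simp: left_shift_def)
  moreover have mixing: "strong_mixing_system X left_shift"
    by (rule strong_mixing_progression_free_shift [OF top])
  moreover have "transitive_system X left_shift"
    using mixing by (rule strong_mixing_imp_transitive)
  moreover have double: "double_recurrent_points X left_shift = {?zero}"
    by (rule double_recurrent_points_progression_free_shift [OF top])
  moreover have "mtopology_of X closure_of (double_recurrent_points X left_shift) \<noteq> mspace X"
    using one closed_zero by (auto simp: double closure_of_closedin)
  ultimately show ?thesis
    by (intro exI [of _ X] exI [of _ left_shift]) simp
qed

end
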